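(* Let $\mathcal H$ be a real Hilbert space, $f,g,h$ proper closed convex functions on $\mathcal H$ with $h$ differentiable and $\nabla h$ $(1/\beta)$-Lipschitz, $\beta>0$. Set $A=\partial f$, $B=\partial g$, $C=\nabla h$. Let $\varepsilon\in(0,1)$, $\gamma\in(0,2\beta\varepsilon)$, $\alpha=1/(2-\varepsilon)$, $(\lambda_j)_{j\ge0}\subseteq(0,1/\alpha)$ with $\underline\tau:=\inf_{j\ge0}\lambda_j(1-\alpha\lambda_j)/\alpha>0$. Let $T:=I_{\mathcal H}-J_{\gamma B}+J_{\gamma A}\circ(2J_{\gamma B}-I_{\mathcal H}-\gamma C\circ J_{\gamma B})$ have a fixed point $z^\ast$, and let $x^\ast=J_{\gamma B}(z^\ast)$, $u_B^\ast=\gamma^{-1}(z^\ast-x^\ast)$. Let $z^0\in\mathcal H$, $z^{k+1}=(1-\lambda_k)z^k+\lambda_kTz^k$, $x_g^k:=J_{\gamma B}(z^k)$, $x_f^k:=J_{\gamma A}(2x_g^k-z^k-\gamma\nabla h(x_g^k))$. Then: 1. For all $k\ge0$, $$\frac{-\|z^0-z^\ast\|\,\|u_B^\ast+\nabla h(x^\ast)\|}{\sqrt{\underline\tau(k+1)}}\le f(x_f^k)+g(x_g^k)+h(x_g^k)-(f+g+h)(x^\ast)\le\frac{\left(\|z^\ast-x^\ast\|+(1+\gamma/\beta)\|z^0-z^\ast\|+\gamma\|\nabla h(x^\ast)\|\right)\|z^0-z^\ast\|}{\gamma\sqrt{\underline\tau(k+1)}}$$ and $|f(x_f^k)+g(x_g^k)+h(x_g^k)-(f+g+h)(x^\ast)|=o\left(\frac1{\sqrt{k+1}}\right)$.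 2. Suppose $f$ is $L$-Lipschitz continuous on the closed ball of center $x^\ast$ and radius $(1+\gamma/\beta)\|z^0-z^\ast\|$. Then for all $k\ge0$ $$0\le f(x_g^k)+g(x_g^k)+h(x_g^k)-(f+g+h)(x^\ast)\le\frac{\left(\|z^\ast-x^\ast\|+(1+\gamma/\beta)\|z^0-z^\ast\|+\gamma\|\nabla h(x^\ast)\|\right)\|z^0-z^\ast\|+\gamma L\|z^0-z^\ast\|}{\gamma\sqrt{\underline\tau(k+1)}}$$ and $0\le f(x_g^k)+g(x_g^k)+h(x_g^k)-(f+g+h)(x^\ast)=o\left(\frac1{\sqrt{k+1}}\right)$.
   Context: $J_S:=(I_{\mathcal H}+S)^{-1}$ is the resolvent of a maximal monotone operator $S$; $\partial$ is the convex subdifferential. *)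

theory Defs
  imports "HOL-Analysis.Analysis" "HOL-Library.Landau_Symbols"
begin

definition ereal_epigraph :: "('a \<Rightarrow> ereal) \<Rightarrow> ('a \<times> real) set" where
  "ereal_epigraph f = {(x, r). f x \<le> ereal r}"

definition proper_closed_convex :: "('a::real_inner \<Rightarrow> ereal) \<Rightarrow> bool" where
  "proper_closed_convex f \<longleftrightarrow>
     (\<forall>x. f x \<noteq> -\<infinity>) \<and> (\<exists>x. f x \<noteq> \<infinity>) \<and>
     closed (ereal_epigraph f) \<and> convex (ereal_epigraph f)"

(* If f is proper, this set is empty wherever f takes the value \<infinity>. *)
definition subdifferential :: "('a::real_inner \<Rightarrow> ereal) \<Rightarrow> 'a \<Rightarrow> 'a set" where
  "subdifferential f x = {u. \<forall>y. f y \<ge> f x + ereal (u \<bullet> (y - x))}"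

definition scale_op :: "real \<Rightarrow> ('a::real_vector \<Rightarrow> 'a set) \<Rightarrow> 'a \<Rightarrow> 'a set" where
  "scale_op c S x = (\<lambda>u. c *\<^sub>R u) ` S x"

(* The inverse of I + S, evaluated at z: the x with z \<in> x + S x. For a maximal monotone S on a
   Hilbert space there is exactly one such x (Minty); for other S the value may be unspecified. *)
definition resolvent :: "('a::real_vector \<Rightarrow> 'a set) \<Rightarrow> 'a \<Rightarrow> 'a" where
  "resolvent S z = (THE x. \<exists>u\<in>S x. x + u = z)"

definition three_op_map ::
  "real \<Rightarrow> ('a::real_vector \<Rightarrow> 'a set) \<Rightarrow> ('a \<Rightarrow> 'a set) \<Rightarrow> ('a \<Rightarrow> 'a) \<Rightarrow> 'a \<Rightarrow> 'a" where
  "three_op_map \<gamma> A B C z =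
     z - resolvent (scale_op \<gamma> B) z +
     resolvent (scale_op \<gamma> A)
       (2 *\<^sub>R resolvent (scale_op \<gamma> B) z - z - \<gamma> *\<^sub>R C (resolvent (scale_op \<gamma> B) z))"

(* Lipschitz continuity of an extended-valued function on S includes finiteness on S. *)
definition ereal_lipschitz_on :: "real \<Rightarrow> 'a::metric_space set \<Rightarrow> ('a \<Rightarrow> ereal) \<Rightarrow> bool" where
  "ereal_lipschitz_on L S f \<longleftrightarrow>
     (\<forall>x\<in>S. \<bar>f x\<bar> \<noteq> \<infinity>) \<and> L-lipschitz_on S (\<lambda>x. real_of_ereal (f x))"

end

theory Submission
  imports Defs
begin

text \<open>Write \<open>R z = z - T z = x\<^sub>g - x\<^sub>f\<close>. The resolvents are proximal maps, so
  \<open>R z = \<gamma> (u\<^sub>A + u\<^sub>B + \<nabla>h x\<^sub>g)\<close> for subgradients \<open>u\<^sub>A\<close> of \<open>f\<close> at \<open>x\<^sub>f\<close> and \<open>u\<^sub>B\<close> of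
  \<open>g\<close> at \<open>x\<^sub>g\<close>. Monotonicity of \<open>\<partial>f\<close>, \<open>\<partial>g\<close> and the Baillon--Haddad theorem for \<open>\<nabla>h\<close> make
  \<open>R\<close> cocoercive with constant \<open>1 - \<gamma> / (4 \<beta>) \<ge> 1 / (2 \<alpha>)\<close>. Hence along the iteration the
  distance to \<open>z\<^sup>*\<close> and \<open>\<parallel>R z\<^sup>k\<parallel>\<close> decrease and \<open>\<tau> \<Sum> \<parallel>R z\<^sup>k\<parallel>\<^sup>2 \<le> \<parallel>z\<^sup>0 - z\<^sup>*\<parallel>\<^sup>2\<close>, which gives both
  the explicit rate and the little-o rate of \<open>\<parallel>R z\<^sup>k\<parallel>\<close>. Subgradient inequalities bound the
  objective gap by a constant times \<open>\<parallel>R z\<^sup>k\<parallel>\<close>.\<close>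

section \<open>Proximal maps\<close>

text \<open>Let \<open>t\<close> tend to 0 from the right. Used after moving a fraction
  \<open>t\<close> along a segment and dividing by \<open>t\<close>: the second-order error
  disappears.\<close>

lemma nonneg_if_nonneg_add_small:
  fixes a b :: real
  assumes "\<And>t. 0 < t \<Longrightarrow> t \<le> 1 \<Longrightarrow> 0 \<le> a + t * b"
  shows "0 \<le> a"
proof -
  have "((\<lambda>t. a + t * b) \<longlongrightarrow> a + 0 * b) (at_right 0)"
    by (intro tendsto_intros)
  moreover have "\<forall>\<^sub>F t in at_right 0. 0 \<le> a + t * b"
    unfolding eventually_at_right_field using assms by (intro exI[of _ 1]) auto
  ultimately show ?thesis
    using tendsto_lowerbound[of "\<lambda>t. a + t * b" "a + 0 * b" "at_right 0" 0] by simp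
qed

text \<open>A substitute for an affine minorant, obtained without separation theorems. Closedness
  keeps a ball around a point below the graph outside the epigraph, which bounds \<open>f\<close>
  below near \<open>x0\<close>; convexity carries the bound outwards along segments from
  \<open>x0\<close>, at the price of linear decay.\<close>

lemma proper_closed_convex_conical_minorant:
  fixes f :: "'a::real_inner \<Rightarrow> ereal"
  assumes f: "proper_closed_convex f"
  obtains x0 c \<delta> where "\<delta> > 0"
    "\<And>x r. (x, r) \<in> ereal_epigraph f \<Longrightarrow> r \<ge> c - norm (x - x0) / \<delta>"
proof -
  let ?E = "ereal_epigraph f"
  have cl: "closed ?E" and cv: "convex ?E"
    using f by (auto simp: proper_closed_convex_def)
  obtain x0 where x0: "f x0 \<noteq> \<infinity>" "f x0 \<noteq> -\<infinity>"
    using f by (auto simp: proper_closed_convex_def)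
  then obtain c where c: "f x0 = ereal c" by (cases "f x0") auto
  have "(x0, c - 1) \<in> - ?E" by (simp add: ereal_epigraph_def c)
  with cl obtain e where e: "e > 0" "ball (x0, c - 1) e \<subseteq> - ?E"
    by (metis open_Compl open_contains_ball)
  define \<delta> where "\<delta> = e / 2"
  have \<delta>: "\<delta> > 0" "\<delta> < e" using e by (auto simp: \<delta>_def)
  have near: "r > c - 1" if "(x, r) \<in> ?E" "norm (x - x0) \<le> \<delta>" for x r
  proof (rule ccontr)
    assume "\<not> r > c - 1"
    then have "(x, c - 1) \<in> ?E"
      using that(1) by (auto simp: ereal_epigraph_def intro: order_trans)
    moreover have "(x, c - 1) \<in> ball (x0, c - 1) e"
      using that(2) \<delta> by (simp add: dist_Pair_Pair dist_norm norm_minus_commute)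
    ultimately show False using e by blast
  qed
  have "r \<ge> (c - 1) - norm (x - x0) / \<delta>" if xr: "(x, r) \<in> ?E" for x r
  proof (cases "norm (x - x0) \<le> \<delta>")
    case True
    have "0 \<le> norm (x - x0) / \<delta>" using \<delta> by simp
    then show ?thesis using near[OF xr True] by linarith
  next
    case False
    \<comment> \<open>The point at fraction \<open>t\<close> of the segment from \<open>x0\<close>
      to \<open>x\<close> has distance exactly \<open>\<delta>\<close> from \<open>x0\<close>, so
      \<open>near\<close> applies to it.\<close>
    define t where "t = \<delta> / norm (x - x0)"
    have "0 < norm (x - x0)" "\<delta> < norm (x - x0)" using False \<delta> by linarith+
    then have t: "0 < t" "t < 1" "t * norm (x - x0) = \<delta>"
      using \<delta> by (simp_all add: t_def)
    have "(1 - t) *\<^sub>R (x0, c) + t *\<^sub>R (x, r) \<in> ?E"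
      using t by (intro convexD[OF cv]) (auto simp: xr, simp add: ereal_epigraph_def c)
    then have "(x0 + t *\<^sub>R (x - x0), (1 - t) * c + t * r) \<in> ?E"
      by (simp add: algebra_simps)
    then have "(1 - t) * c + t * r > c - 1"
      by (rule near) (use t in simp)
    then have "t * (c - r) < 1" by (simp add: algebra_simps)
    then have "c - r < 1 / t" using t by (simp add: field_simps)
    also have "1 / t = norm (x - x0) / \<delta>" by (simp add: t_def)
    finally show ?thesis by simp
  qed
  then show thesis by (rule that[OF \<delta>(1)])
qed

text \<open>Minimising sequences are Cauchy by the parallelogram identity. Working with points of the
  epigraph replaces lower semicontinuity of \<open>f\<close> by closedness of a set.\<close>

lemma prox_objective_attains_min:
  fixes f :: "'a::{real_inner, complete_space} \<Rightarrow> ereal" and z :: 'a and \<gamma> :: real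
  assumes f: "proper_closed_convex f" and \<gamma>: "\<gamma> > 0"
  obtains p q where "(p, q) \<in> ereal_epigraph f"
    "\<And>x r. (x, r) \<in> ereal_epigraph f \<Longrightarrow>
       q + (norm (p - z))\<^sup>2 / (2 * \<gamma>) \<le> r + (norm (x - z))\<^sup>2 / (2 * \<gamma>)"
proof -
  let ?E = "ereal_epigraph f"
  define \<Phi> where "\<Phi> = (\<lambda>(x, r). r + (norm (x - z))\<^sup>2 / (2 * \<gamma>))"
  have cl: "closed ?E" and cv: "convex ?E"
    using f by (auto simp: proper_closed_convex_def)
  obtain x0 where x0: "f x0 \<noteq> \<infinity>" "f x0 \<noteq> -\<infinity>"
    using f by (auto simp: proper_closed_convex_def)
  then have "(x0, real_of_ereal (f x0)) \<in> ?E" by (cases "f x0") (auto simp: ereal_epigraph_def)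
  then have ne: "?E \<noteq> {}" by blast
  obtain x1 c \<delta> where minor: "\<delta> > 0"
    "\<And>x r. (x, r) \<in> ?E \<Longrightarrow> r \<ge> c - norm (x - x1) / \<delta>"
    by (rule proper_closed_convex_conical_minorant[OF f]) (rule that)
  have "\<Phi> e \<ge> c - norm (z - x1) / \<delta> - \<gamma> / (2 * \<delta>\<^sup>2)" if "e \<in> ?E" for e
  proof -
    obtain x r where e: "e = (x, r)" by force
    define s where "s = norm (x - z)"
    have "norm (x - x1) \<le> s + norm (z - x1)"
      unfolding s_def using norm_triangle_ineq[of "x - z" "z - x1"] by simp
    then have "norm (x - x1) / \<delta> \<le> (s + norm (z - x1)) / \<delta>"
      using minor(1) by (simp add: divide_right_mono)
    \<comment> \<open>Completing the square: the quadratic term absorbs the linear decay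
      \<open>s / \<delta>\<close> up to a constant independent of the point.\<close>
    moreover have "0 \<le> (s - \<gamma> / \<delta>)\<^sup>2 / (2 * \<gamma>)" using \<gamma> by simp
    then have "s / \<delta> \<le> s\<^sup>2 / (2 * \<gamma>) + \<gamma> / (2 * \<delta>\<^sup>2)"
      using \<gamma> minor(1) by (simp add: power2_eq_square field_simps)
    moreover have "r \<ge> c - norm (x - x1) / \<delta>" using minor(2) that e by blast
    ultimately show ?thesis
      by (simp add: e \<Phi>_def s_def[symmetric] add_divide_distrib)
  qed
  then have bdd: "bdd_below (\<Phi> ` ?E)" by (intro bdd_belowI2) blast
  define m where "m = Inf (\<Phi> ` ?E)"
  have m_le: "m \<le> \<Phi> e" if "e \<in> ?E" for e
    unfolding m_def using bdd that by (intro cInf_lower) auto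
  have "\<exists>e\<in>?E. \<Phi> e < m + 1 / real (Suc n)" for n
  proof -
    have "Inf (\<Phi> ` ?E) < m + 1 / real (Suc n)" by (simp add: m_def)
    then obtain y where "y \<in> \<Phi> ` ?E" "y < m + 1 / real (Suc n)"
      using cInf_lessD[of "\<Phi> ` ?E"] ne by blast
    then show ?thesis by blast
  qed
  then obtain e where e: "\<And>n. e n \<in> ?E" "\<And>n. \<Phi> (e n) < m + 1 / real (Suc n)"
    by metis
  define x where "x n = fst (e n)" for n
  define r where "r n = snd (e n)" for n
  have xr: "e n = (x n, r n)" for n by (simp add: x_def r_def)
  have average_ineq: "2 * M \<le> s + a + (t + b) - d"
    if "M \<le> (s + t) / 2 + c" "c = (a + b) / 2 - d / 2" for M s t a b c d :: real
    using that by (simp add: field_simps)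
  \<comment> \<open>The midpoint of \<open>e i\<close> and \<open>e j\<close> lies in the epigraph,
    so its \<open>\<Phi>\<close> is at least \<open>m\<close>. Both endpoint values exceed
    \<open>m\<close> by less than \<open>1 / (N + 1)\<close>, and the factor
    \<open>1 / (4 * \<gamma>)\<close> of the parallelogram term turns the total
    \<open>2 / (N + 1)\<close> into \<open>8 * \<gamma> / (N + 1)\<close>.\<close>
  have sq: "(norm (x i - x j))\<^sup>2 \<le> 8 * \<gamma> / real (Suc N)" if "N \<le> i" "N \<le> j" for i j N
  proof -
    have "(1/2) *\<^sub>R (x i, r i) + (1/2) *\<^sub>R (x j, r j) \<in> ?E"
      using e(1)[of i] e(1)[of j] unfolding xr by (intro convexD[OF cv]) auto
    from m_le[OF this] have "m \<le> (r i + r j) / 2 +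
        (norm ((1/2) *\<^sub>R (x i - z) + (1/2) *\<^sub>R (x j - z)))\<^sup>2 / (2 * \<gamma>)"
      by (simp add: \<Phi>_def algebra_simps scaleR_2[symmetric] add_divide_distrib)
    moreover have "(norm ((1/2) *\<^sub>R (x i - z) + (1/2) *\<^sub>R (x j - z)))\<^sup>2 =
       ((norm (x i - z))\<^sup>2 + (norm (x j - z))\<^sup>2) / 2 - (norm (x i - x j))\<^sup>2 / 4"
      unfolding power2_norm_eq_inner
      by (simp add: inner_simps inner_commute field_simps)
    then have "(norm ((1/2) *\<^sub>R (x i - z) + (1/2) *\<^sub>R (x j - z)))\<^sup>2 / (2 * \<gamma>) =
       ((norm (x i - z))\<^sup>2 / (2 * \<gamma>) + (norm (x j - z))\<^sup>2 / (2 * \<gamma>)) / 2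
         - (norm (x i - x j))\<^sup>2 / (4 * \<gamma>) / 2"
      by (simp add: add_divide_distrib diff_divide_distrib)
    ultimately have "2 * m \<le> \<Phi> (e i) + \<Phi> (e j) - (norm (x i - x j))\<^sup>2 / (4 * \<gamma>)"
      unfolding \<Phi>_def xr prod.case by (rule average_ineq)
    moreover have "1 / real (Suc i) \<le> 1 / real (Suc N)" "1 / real (Suc j) \<le> 1 / real (Suc N)"
      using that by (auto intro!: divide_left_mono)
    ultimately have "(norm (x i - x j))\<^sup>2 / (4 * \<gamma>) \<le> 2 / real (Suc N)"
      using e(2)[of i] e(2)[of j] by linarith
    then show ?thesis using \<gamma> by (simp add: divide_simps mult_ac split: if_splits)
  qed
  have "Cauchy x"
  proof (rule metric_CauchyI)
    fix d :: real assume d: "0 < d"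
    have "(\<lambda>N. 8 * \<gamma> / real (Suc N)) \<longlonglongrightarrow> 0"
      using lim_const_over_n[of "8 * \<gamma>"] LIMSEQ_Suc by blast
    then have "\<forall>\<^sub>F N in sequentially. 8 * \<gamma> / real (Suc N) < d\<^sup>2"
      using d by (intro order_tendstoD) auto
    then obtain N where N: "8 * \<gamma> / real (Suc N) < d\<^sup>2"
      by (auto simp: eventually_sequentially)
    show "\<exists>M. \<forall>i\<ge>M. \<forall>j\<ge>M. dist (x i) (x j) < d"
    proof (intro exI[of _ N] allI impI)
      fix i j assume "N \<le> i" "N \<le> j"
      then have "(norm (x i - x j))\<^sup>2 < d\<^sup>2" using N by (intro le_less_trans[OF sq])
      then show "dist (x i) (x j) < d"
        using d by (simp add: dist_norm power_less_imp_less_base)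
    qed
  qed
  then obtain p where p: "x \<longlonglongrightarrow> p" using Cauchy_convergent convergent_def by blast
  have "(\<lambda>n. m + 1 / real (Suc n)) \<longlonglongrightarrow> m + 0"
    by (intro tendsto_add tendsto_const LIMSEQ_Suc[OF lim_const_over_n])
  then have "(\<lambda>n. \<Phi> (e n)) \<longlonglongrightarrow> m"
    by (intro tendsto_sandwich[of "\<lambda>_. m" "\<lambda>n. \<Phi> (e n)" sequentially "\<lambda>n. m + 1 / real (Suc n)"])
      (use m_le[OF e(1)] less_imp_le[OF e(2)] in simp_all)
  then have "(\<lambda>n. \<Phi> (e n) - (norm (x n - z))\<^sup>2 / (2 * \<gamma>)) \<longlonglongrightarrow> m - (norm (p - z))\<^sup>2 / (2 * \<gamma>)"
    using p \<gamma> by (intro tendsto_intros) auto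
  \<comment> \<open>The heights \<open>r n\<close> converge as well, because
    \<open>\<Phi> (e n)\<close> and its quadratic part do; \<open>q\<close> is their limit, and
    \<open>\<Phi>\<close> equals \<open>m\<close> at \<open>(p, q)\<close>.\<close>
  moreover define q where "q = m - (norm (p - z))\<^sup>2 / (2 * \<gamma>)"
  ultimately have "r \<longlonglongrightarrow> q" by (simp add: \<Phi>_def xr)
  with p have "e \<longlonglongrightarrow> (p, q)" unfolding xr[abs_def] by (intro tendsto_Pair)
  then have "(p, q) \<in> ?E" using cl e(1) closed_sequentially by blast
  moreover have "q + (norm (p - z))\<^sup>2 / (2 * \<gamma>) \<le> t + (norm (y - z))\<^sup>2 / (2 * \<gamma>)"
    if "(y, t) \<in> ?E" for y t
    using m_le[OF that] by (simp add: q_def \<Phi>_def)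
  ultimately show thesis by (rule that)
qed

lemma subdifferential_finite:
  assumes "proper_closed_convex f" "u \<in> subdifferential f x"
  shows "\<bar>f x\<bar> \<noteq> \<infinity>"
proof -
  obtain y where "f y \<noteq> \<infinity>" "f x \<noteq> -\<infinity>"
    using assms(1) by (auto simp: proper_closed_convex_def)
  moreover have "f x + ereal (u \<bullet> (y - x)) \<le> f y"
    using assms(2) by (auto simp: subdifferential_def)
  ultimately show ?thesis by (cases "f x") auto
qed

lemma subdifferential_le:
  assumes "u \<in> subdifferential f x" "\<bar>f x\<bar> \<noteq> \<infinity>" "\<bar>f y\<bar> \<noteq> \<infinity>"
  shows "real_of_ereal (f x) + u \<bullet> (y - x) \<le> real_of_ereal (f y)"
proof -
  have "f x + ereal (u \<bullet> (y - x)) \<le> f y"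
    using assms(1) by (simp add: subdifferential_def)
  then show ?thesis using assms(2,3) by (cases "f x"; cases "f y") auto
qed

lemma subdifferential_monotone:
  assumes f: "proper_closed_convex f"
    and u: "u \<in> subdifferential f x" and v: "v \<in> subdifferential f y"
  shows "0 \<le> (x - y) \<bullet> (u - v)"
proof -
  note fin = subdifferential_finite[OF f u] subdifferential_finite[OF f v]
  show ?thesis
    using subdifferential_le[OF u fin] subdifferential_le[OF v fin(2,1)]
    by (simp add: inner_simps inner_commute)
qed

text \<open>Minty's surjectivity theorem for a subdifferential: the minimiser of the proximal
  objective solves the inclusion by its first-order condition.\<close>

lemma ex_resolvent_subdifferential:
  fixes f :: "'a::{real_inner, complete_space} \<Rightarrow> ereal"
  assumes f: "proper_closed_convex f" and \<gamma>: "\<gamma> > 0"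
  shows "\<exists>p. \<exists>u\<in>subdifferential f p. p + \<gamma> *\<^sub>R u = z"
proof -
  let ?E = "ereal_epigraph f"
  obtain p q where pq: "(p, q) \<in> ?E"
    "\<And>x r. (x, r) \<in> ?E \<Longrightarrow> q + (norm (p - z))\<^sup>2 / (2 * \<gamma>) \<le> r + (norm (x - z))\<^sup>2 / (2 * \<gamma>)"
    by (rule prox_objective_attains_min[OF f \<gamma>, where z = z]) (rule that)
  have cv: "convex ?E" and f_mninf: "\<And>x. f x \<noteq> -\<infinity>"
    using f by (auto simp: proper_closed_convex_def)
  define u where "u = (1 / \<gamma>) *\<^sub>R (z - p)"
  have "f p + ereal (u \<bullet> (y - p)) \<le> f y" for y
  proof (cases "f y")
    case (real s)
    then have y: "(y, s) \<in> ?E" by (simp add: ereal_epigraph_def)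
    \<comment> \<open>Minimality of \<open>(p, q)\<close> against the point at fraction
      \<open>t\<close> of the segment to \<open>(y, s)\<close>; a common factor \<open>t\<close>
      cancels.\<close>
    have "0 \<le> (s - q - u \<bullet> (y - p)) + t * ((norm (y - p))\<^sup>2 / (2 * \<gamma>))"
      if t: "0 < t" "t \<le> 1" for t
    proof -
      have "(1 - t) *\<^sub>R (p, q) + t *\<^sub>R (y, s) \<in> ?E"
        using t by (intro convexD[OF cv] pq y) auto
      then have "((p + t *\<^sub>R (y - p)), (1 - t) * q + t * s) \<in> ?E"
        by (simp add: algebra_simps)
      from pq(2)[OF this] have
        "q + (norm (p - z))\<^sup>2 / (2 * \<gamma>) \<le> (1 - t) * q + t * s + (norm ((p - z) + t *\<^sub>R (y - p)))\<^sup>2 / (2 * \<gamma>)"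
        by (simp add: algebra_simps)
      moreover define N where "N = (norm ((p - z) + t *\<^sub>R (y - p)))\<^sup>2"
      moreover have "(norm ((p - z) + t *\<^sub>R (y - p)))\<^sup>2 =
          (norm (p - z))\<^sup>2 - 2 * t * \<gamma> * (u \<bullet> (y - p)) + t * t * (norm (y - p))\<^sup>2"
        using \<gamma> unfolding power2_norm_eq_inner u_def
        by (simp add: inner_simps inner_commute algebra_simps)
      ultimately have "q + (norm (p - z))\<^sup>2 / (2 * \<gamma>) \<le> (1 - t) * q + t * s + N / (2 * \<gamma>)"
        "N = (norm (p - z))\<^sup>2 - 2 * t * \<gamma> * (u \<bullet> (y - p)) + t * t * (norm (y - p))\<^sup>2"
        by simp_all
      then have "N / (2 * \<gamma>) =
          (norm (p - z))\<^sup>2 / (2 * \<gamma>) - t * (u \<bullet> (y - p)) + t * (t * ((norm (y - p))\<^sup>2 / (2 * \<gamma>)))"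
        "q + (norm (p - z))\<^sup>2 / (2 * \<gamma>) \<le> (1 - t) * q + t * s + N / (2 * \<gamma>)"
        using \<gamma> by (simp_all add: add_divide_distrib diff_divide_distrib)
      then have "0 \<le> t * ((s - q - u \<bullet> (y - p)) + t * ((norm (y - p))\<^sup>2 / (2 * \<gamma>)))"
        by (simp add: algebra_simps)
      then show ?thesis using t by (simp add: zero_le_mult_iff)
    qed
    then have "0 \<le> s - q - u \<bullet> (y - p)" by (rule nonneg_if_nonneg_add_small)
    \<comment> \<open>That \<open>q\<close> lies on or above \<open>f p\<close> is the right
      direction: replacing \<open>q\<close> by \<open>f p\<close> weakens the inequality at
      \<open>y\<close>.\<close>
    moreover have "f p \<le> ereal q" using pq(1) by (simp add: ereal_epigraph_def)
    ultimately show ?thesis using real f_mninf[of p] by (cases "f p") auto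
  qed (use f_mninf in auto)
  then have "u \<in> subdifferential f p" by (simp add: subdifferential_def)
  moreover have "p + \<gamma> *\<^sub>R u = z" using \<gamma> by (simp add: u_def)
  ultimately show ?thesis by blast
qed

text \<open>Gives the definite description in \<open>resolvent\<close> its meaning. For uniqueness,
  two solutions differ by \<open>- \<gamma> (u - u')\<close>, whose inner product with
  \<open>p - p'\<close> is nonpositive by monotonicity, yet it is the square of
  \<open>norm (p - p')\<close>.\<close>

lemma resolvent_subdifferential:
  fixes f :: "'a::{real_inner, complete_space} \<Rightarrow> ereal"
  assumes f: "proper_closed_convex f" and \<gamma>: "\<gamma> > 0"
  shows "(1 / \<gamma>) *\<^sub>R (z - resolvent (scale_op \<gamma> (subdifferential f)) z)
           \<in> subdifferential f (resolvent (scale_op \<gamma> (subdifferential f)) z)"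
proof -
  define P where "P p \<longleftrightarrow> (\<exists>u\<in>subdifferential f p. p + \<gamma> *\<^sub>R u = z)" for p
  obtain p0 where p0: "P p0"
    using ex_resolvent_subdifferential[OF f \<gamma>, of z] unfolding P_def by (elim exE)
  have unique: "p = p'" if pp': "P p" "P p'" for p p'
  proof -
    obtain u where u: "u \<in> subdifferential f p" "p + \<gamma> *\<^sub>R u = z"
      using pp'(1) unfolding P_def by (elim bexE)
    obtain u' where u': "u' \<in> subdifferential f p'" "p' + \<gamma> *\<^sub>R u' = z"
      using pp'(2) unfolding P_def by (elim bexE)
    have "p - p' = - (\<gamma> *\<^sub>R (u - u'))"
      using u(2) u'(2) by (simp add: algebra_simps)
    then have "(norm (p - p'))\<^sup>2 = - (\<gamma> * ((p - p') \<bullet> (u - u')))"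
      unfolding power2_norm_eq_inner by (metis inner_minus_right inner_scaleR_right)
    moreover have "0 \<le> \<gamma> * ((p - p') \<bullet> (u - u'))"
      using subdifferential_monotone[OF f u(1) u'(1)] \<gamma> by simp
    ultimately have "(norm (p - p'))\<^sup>2 \<le> 0" by linarith
    then show ?thesis by simp
  qed
  have "P (THE p. P p)" by (rule theI[of P, OF p0 unique[OF _ p0]])
  moreover have "resolvent (scale_op \<gamma> (subdifferential f)) z = (THE p. P p)"
    by (simp add: P_def resolvent_def scale_op_def)
  ultimately have "P (resolvent (scale_op \<gamma> (subdifferential f)) z)" by simp
  then obtain u where u: "u \<in> subdifferential f (resolvent (scale_op \<gamma> (subdifferential f)) z)"
    "z = resolvent (scale_op \<gamma> (subdifferential f)) z + \<gamma> *\<^sub>R u"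
    unfolding P_def by (elim bexE) simp
  have "z - resolvent (scale_op \<gamma> (subdifferential f)) z = \<gamma> *\<^sub>R u"
    using u(2) by (simp only: diff_eq_eq add.commute)
  then show ?thesis using u(1) \<gamma> by simp
qed

section \<open>Convex functions with Lipschitz gradient\<close>

text \<open>Along the segment, the derivative of \<open>h\<close> minus the quadratic model is
  nonpositive by Cauchy-Schwarz and the Lipschitz bound. Stated without convexity so that it also
  applies to \<open>-h\<close>.\<close>

lemma gradient_descent_lemma:
  fixes h :: "'a::real_inner \<Rightarrow> real"
  assumes grad: "\<And>x. GDERIV h x :> g x" and lip: "M-lipschitz_on UNIV g"
  shows "h y \<le> h x + g x \<bullet> (y - x) + M / 2 * (norm (y - x))\<^sup>2"
proof -
  define d where "d = y - x"
  \<comment> \<open>\<open>h\<close> minus the non-constant part of its quadratic model at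
    \<open>x\<close>, along the segment; the claim is
    \<open>\<phi> 1 \<le> \<phi> 0\<close>.\<close>
  define \<phi> where "\<phi> t = h (x + t *\<^sub>R d) - t * (g x \<bullet> d) - M / 2 * t\<^sup>2 * (norm d)\<^sup>2" for t
  have "\<phi> 1 \<le> \<phi> 0"
  proof (rule DERIV_nonpos_imp_nonincreasing[of 0 1 \<phi>])
    fix t :: real assume t: "0 \<le> t"
    have "((\<lambda>t. x + t *\<^sub>R d) has_derivative (\<lambda>s. 0 + s *\<^sub>R d)) (at t)"
      by (intro has_derivative_add has_derivative_const has_derivative_scaleR_left has_derivative_ident)
    from has_derivative_compose[OF this grad[unfolded gderiv_def]]
    have "((\<lambda>t. h (x + t *\<^sub>R d)) has_real_derivative g (x + t *\<^sub>R d) \<bullet> d) (at t)"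
      unfolding has_field_derivative_def
      by (rule has_derivative_eq_rhs) (simp add: fun_eq_iff inner_commute)
    moreover have square: "((\<lambda>t::real. t\<^sup>2) has_real_derivative 2 * t) (at t)"
      by (rule DERIV_cong[OF DERIV_pow]) simp
    ultimately have "(\<phi> has_real_derivative
        g (x + t *\<^sub>R d) \<bullet> d - 1 * (g x \<bullet> d) - M / 2 * (2 * t) * (norm d)\<^sup>2) (at t)"
      unfolding \<phi>_def[abs_def]
      by (intro DERIV_diff DERIV_cmult_right DERIV_cmult DERIV_ident square)
    then have "(\<phi> has_real_derivative g (x + t *\<^sub>R d) \<bullet> d - g x \<bullet> d - M * t * (norm d)\<^sup>2) (at t)"
      by simp
    moreover have "g (x + t *\<^sub>R d) \<bullet> d - g x \<bullet> d \<le> M * t * (norm d)\<^sup>2"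
    proof -
      have "g (x + t *\<^sub>R d) \<bullet> d - g x \<bullet> d \<le> norm (g (x + t *\<^sub>R d) - g x) * norm d"
        using norm_cauchy_schwarz[of "g (x + t *\<^sub>R d) - g x" d] by (simp add: inner_diff_left)
      also have "\<dots> \<le> (M * norm (t *\<^sub>R d)) * norm d"
        using lipschitz_onD[OF lip, of "x + t *\<^sub>R d" x]
        by (intro mult_right_mono) (simp_all add: dist_norm)
      finally show ?thesis using t by (simp add: power2_eq_square)
    qed
    ultimately show "\<exists>y. (\<phi> has_real_derivative y) (at t) \<and> y \<le> 0"
      by (intro exI[of _ "g (x + t *\<^sub>R d) \<bullet> d - g x \<bullet> d - M * t * (norm d)\<^sup>2"]) simp
  qed simp
  then show ?thesis by (simp add: \<phi>_def d_def)
qed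

text \<open>The quadratic lower bound comes from the descent lemma applied to \<open>-h\<close>.\<close>

lemma convex_gradient_ineq:
  fixes h :: "'a::real_inner \<Rightarrow> real"
  assumes h: "convex_on UNIV h"
    and grad: "\<And>x. GDERIV h x :> g x" and lip: "M-lipschitz_on UNIV g"
  shows "h x + g x \<bullet> (y - x) \<le> h y"
proof -
  have "0 \<le> (h y - h x - g x \<bullet> (y - x)) + t * (M / 2 * (norm (y - x))\<^sup>2)"
    if t: "0 < t" "t \<le> 1" for t
  proof -
    define d w where "d = y - x" and "w = x + t *\<^sub>R d"
    have "M-lipschitz_on UNIV (\<lambda>x. - g x)"
      using lip by (simp add: lipschitz_on_minus)
    from gradient_descent_lemma[of "\<lambda>x. - h x" "\<lambda>x. - g x", OF GDERIV_minus[OF grad] this]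
    have "- h w \<le> - h x + (- g x) \<bullet> (w - x) + M / 2 * (norm (w - x))\<^sup>2" .
    moreover have "w - x = t *\<^sub>R d" by (simp add: w_def)
    moreover have "(1 - t) *\<^sub>R x + t *\<^sub>R y = w" by (simp add: w_def d_def algebra_simps)
    then have "h w \<le> (1 - t) * h x + t * h y"
      using convex_onD[OF h, of t x y] t by simp
    \<comment> \<open>The chord bounds \<open>h w\<close> above, the tangent bounds it below up to
      order \<open>t\<^sup>2\<close>; subtracting leaves a common factor \<open>t\<close>.\<close>
    ultimately have "0 \<le> t * ((h y - h x - g x \<bullet> d) + t * (M / 2 * (norm d)\<^sup>2))"
      by (simp add: power2_eq_square algebra_simps)
    then show ?thesis using t by (simp add: zero_le_mult_iff d_def)
  qed
  then have "0 \<le> h y - h x - g x \<bullet> (y - x)" by (rule nonneg_if_nonneg_add_small)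
  then show ?thesis by simp
qed

text \<open>The value of \<open>h\<close> after the step \<open>- \<beta> (g x - g y)\<close> from
  \<open>x\<close> is bounded above by the descent lemma at \<open>x\<close> and below by the
  tangent at \<open>y\<close>. This improves the tangent inequality by \<open>\<beta> / 2\<close>
  times the squared gradient difference; adding the version with \<open>x\<close> and
  \<open>y\<close> exchanged gives the full constant \<open>\<beta>\<close>.\<close>

lemma Baillon_Haddad:
  fixes h :: "'a::real_inner \<Rightarrow> real"
  assumes h: "convex_on UNIV h" and \<beta>: "\<beta> > 0"
    and grad: "\<And>x. GDERIV h x :> g x" and lip: "(1 / \<beta>)-lipschitz_on UNIV g"
  shows "\<beta> * (norm (g x - g y))\<^sup>2 \<le> (x - y) \<bullet> (g x - g y)"
proof -
  have half: "h y + g y \<bullet> (x - y) + \<beta> / 2 * (norm (g x - g y))\<^sup>2 \<le> h x" for x y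
  proof -
    define v where "v = g x - g y"
    have "h y + g y \<bullet> (x - \<beta> *\<^sub>R v - y) \<le> h (x - \<beta> *\<^sub>R v)"
      by (rule convex_gradient_ineq[OF h grad lip])
    also have "\<dots> \<le> h x - \<beta> * (g x \<bullet> v) + \<beta> / 2 * (norm v)\<^sup>2"
      using gradient_descent_lemma[OF grad lip, of "x - \<beta> *\<^sub>R v" x] \<beta>
      by (simp add: power2_eq_square mult_ac)
    finally have "h y + g y \<bullet> (x - y) + \<beta> * (v \<bullet> v) - \<beta> / 2 * (norm v)\<^sup>2 \<le> h x"
      unfolding v_def by (simp add: inner_simps inner_commute algebra_simps)
    then show ?thesis by (simp add: power2_norm_eq_inner v_def)
  qed
  show ?thesis
    using half[of x y] half[of y x]
    by (simp add: inner_simps inner_commute norm_minus_commute)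
qed

lemma convex_on_if_proper_closed_convex:
  fixes h :: "'a::real_inner \<Rightarrow> real"
  assumes "proper_closed_convex (\<lambda>x. ereal (h x))"
  shows "convex_on UNIV h"
proof (rule convex_onI)
  fix t :: real and x y assume t: "0 < t" "t < 1"
  have "(1 - t) *\<^sub>R (x, h x) + t *\<^sub>R (y, h y) \<in> ereal_epigraph (\<lambda>x. ereal (h x))"
    using assms t unfolding proper_closed_convex_def
    by (intro convexD) (auto simp: ereal_epigraph_def)
  then show "h ((1 - t) *\<^sub>R x + t *\<^sub>R y) \<le> (1 - t) * h x + t * h y"
    by (simp add: ereal_epigraph_def)
qed simp

section \<open>Averaged iterations\<close>

text \<open>The sum over \<open>{n div 2..n}\<close> tends to 0, being a difference of partial sums
  with the same limit. This block holds at least half of the \<open>n + 1\<close> indices up to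
  \<open>n\<close>, and each of its terms is at least \<open>a n\<close>.\<close>

lemma decseq_summable_imp_mult_tendsto_0:
  fixes a :: "nat \<Rightarrow> real"
  assumes dec: "decseq a" and sum: "summable a" and nonneg: "\<And>n. 0 \<le> a n"
  shows "(\<lambda>n. (real n + 1) * a n) \<longlonglongrightarrow> 0"
proof (rule tendsto_sandwich)
  show "\<forall>\<^sub>F n in sequentially. 0 \<le> (real n + 1) * a n"
    by (rule always_eventually) (simp add: nonneg)
  show "(\<lambda>_. 0::real) \<longlonglongrightarrow> 0" by (rule tendsto_const)
  define S where "S n = sum a {..<n}" for n
  have S: "S \<longlonglongrightarrow> suminf a"
    using summable_LIMSEQ[OF sum] by (simp add: S_def[abs_def])
  have "filterlim (\<lambda>n::nat. n div 2) at_top sequentially"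
    by (rule filterlim_at_top_div_const_nat) simp
  from filterlim_compose[OF S this] have "(\<lambda>n. 2 * (S (Suc n) - S (n div 2))) \<longlonglongrightarrow> 2 * (suminf a - suminf a)"
    using LIMSEQ_Suc[OF S] by (intro tendsto_intros)
  then show "(\<lambda>n. 2 * (S (Suc n) - S (n div 2))) \<longlonglongrightarrow> 0" by simp
  have "(real n + 1) * a n \<le> 2 * (S (Suc n) - S (n div 2))" for n
  proof -
    have "real n + 1 \<le> 2 * real (card {n div 2..n})"
      by (simp add: of_nat_diff)
    from mult_right_mono[OF this nonneg[of n]]
    have "(real n + 1) * a n \<le> 2 * (real (card {n div 2..n}) * a n)"
      by (simp only: mult.assoc)
    also have "real (card {n div 2..n}) * a n \<le> sum a {n div 2..n}"
      using dec by (intro sum_bounded_below) (auto dest: decseqD)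
    also have "sum a {n div 2..n} = S (Suc n) - S (n div 2)"
      using sum.atLeastLessThan_concat[OF le0 le_SucI[OF div_le_dividend], of a n 2]
      by (simp add: S_def lessThan_atLeast0 atLeastLessThanSuc_atLeastAtMost)
    finally show ?thesis by linarith
  qed
  then show "\<forall>\<^sub>F n in sequentially. (real n + 1) * a n \<le> 2 * (S (Suc n) - S (n div 2))"
    by (rule always_eventually[OF allI])
qed

text \<open>Cocoercivity of \<open>R = I - T\<close> with constant \<open>1 / (2 \<alpha>)\<close> says that \<open>T\<close> is \<open>\<alpha>\<close>-averaged.\<close>

lemma Krasnoselskii_Mann_residual:
  fixes R :: "'a::real_inner \<Rightarrow> 'a" and z :: "nat \<Rightarrow> 'a"
  assumes coco: "\<And>z w. (norm (R z - R w))\<^sup>2 \<le> 2 * \<alpha> * ((z - w) \<bullet> (R z - R w))"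
    and \<alpha>: "\<alpha> > 0" and fixp: "R z_star = 0"
    and lam: "\<And>k. 0 < lam k" "\<And>k. lam k < 1 / \<alpha>"
    and \<tau>: "\<tau> > 0" "\<And>k. \<tau> \<le> lam k * (1 - \<alpha> * lam k) / \<alpha>"
    and z: "\<And>k. z (Suc k) = z k - lam k *\<^sub>R R (z k)"
  shows Krasnoselskii_Mann_Fejer: "norm (z k - z_star) \<le> norm (z 0 - z_star)" (is ?F)
    and Krasnoselskii_Mann_residual_bound:
      "norm (R (z k)) \<le> norm (z 0 - z_star) / sqrt (\<tau> * (real k + 1))" (is ?B)
    and Krasnoselskii_Mann_residual_smallo:
      "(\<lambda>k. norm (R (z k))) \<in> o(\<lambda>k. 1 / sqrt (real k + 1))" (is ?O)
proof -
  let ?D = "\<lambda>k. (norm (z k - z_star))\<^sup>2" and ?a = "\<lambda>k. (norm (R (z k)))\<^sup>2"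
  \<comment> \<open>Cocoercivity against the zero \<open>z_star\<close>, scaled by
    \<open>lam k / \<alpha>\<close>, controls the cross term of the expanded square; the net
    coefficient \<open>lam k / \<alpha> - (lam k)\<^sup>2\<close> of the squared residual is at
    least \<open>\<tau>\<close>.\<close>
  have descent: "?D (Suc k) \<le> ?D k - \<tau> * ?a k" for k
  proof -
    have "?D (Suc k) = (norm ((z k - z_star) - lam k *\<^sub>R R (z k)))\<^sup>2"
      by (simp add: z algebra_simps)
    also have "\<dots> = ?D k - 2 * lam k * ((z k - z_star) \<bullet> R (z k)) + (lam k)\<^sup>2 * ?a k"
      unfolding power2_norm_eq_inner by (simp add: inner_simps inner_commute power2_eq_square)
    finally have "?D (Suc k) = \<dots>" .
    moreover have "lam k / \<alpha> * ?a k \<le> 2 * lam k * ((z k - z_star) \<bullet> R (z k))"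
      using mult_left_mono[OF coco[of "z k" z_star], of "lam k / \<alpha>"] \<alpha> lam(1)[of k] fixp
      by simp
    moreover have "lam k / \<alpha> * ?a k - (lam k)\<^sup>2 * ?a k = lam k * (1 - \<alpha> * lam k) / \<alpha> * ?a k"
      using \<alpha> by (simp add: power2_eq_square field_simps)
    moreover have "\<tau> * ?a k \<le> lam k * (1 - \<alpha> * lam k) / \<alpha> * ?a k"
      by (rule mult_right_mono[OF \<tau>(2)]) simp
    ultimately show ?thesis by linarith
  qed
  have mono: "?a (Suc k) \<le> ?a k" for k
  proof -
    \<comment> \<open>\<open>z k - z (Suc k)\<close> is \<open>lam k *\<^sub>R R (z k)\<close>, so
      cocoercivity at consecutive iterates compares \<open>v\<close> with \<open>R (z k)\<close>
      itself; \<open>\<alpha> * lam k \<le> 1\<close> then makes the squared residual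
      decrease.\<close>
    define v where "v = R (z k) - R (z (Suc k))"
    have "(norm v)\<^sup>2 \<le> 2 * (\<alpha> * lam k) * (R (z k) \<bullet> v)"
      using coco[of "z k" "z (Suc k)"] by (simp add: z v_def)
    moreover have "0 \<le> 2 * (\<alpha> * lam k) * (R (z k) \<bullet> v)"
      using calculation zero_le_power2[of "norm v"] by linarith
    then have "0 \<le> R (z k) \<bullet> v"
      using \<alpha> lam(1)[of k] by (simp add: zero_le_mult_iff[of "2 * (\<alpha> * lam k)"] mult_le_0_iff)
    moreover have "\<alpha> * lam k \<le> 1" using \<alpha> lam(2)[of k] by (simp add: field_simps)
    ultimately have "(norm v)\<^sup>2 \<le> 2 * (R (z k) \<bullet> v)"
      using mult_right_mono[of "\<alpha> * lam k" 1 "R (z k) \<bullet> v"] by linarith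
    moreover have "?a (Suc k) = ?a k - 2 * (R (z k) \<bullet> v) + (norm v)\<^sup>2"
      unfolding power2_norm_eq_inner v_def by (simp add: inner_simps inner_commute)
    ultimately show ?thesis by simp
  qed
  have dec: "decseq ?a" using mono by (rule decseq_SucI)
  \<comment> \<open>Telescoped descent, the source of the Fejer property, the explicit rate and
    summability.\<close>
  have sum_le: "\<tau> * sum ?a {..<n} + ?D n \<le> ?D 0" for n
  proof (induction n)
    case (Suc n)
    then show ?case using descent[of n] by (simp add: distrib_left)
  qed simp
  have sum_nonneg: "0 \<le> \<tau> * sum ?a {..<n}" for n
    using \<tau>(1) by (simp add: sum_nonneg)
  have "?D k \<le> ?D 0" using sum_le[of k] sum_nonneg[of k] by linarith
  then show ?F by (rule power2_le_imp_le) simp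
  show ?B
  proof -
    \<comment> \<open>The last of \<open>k + 1\<close> decreasing terms is at most their
      average.\<close>
    have "real (card {..<Suc k}) * ?a k \<le> sum ?a {..<Suc k}"
      by (rule sum_bounded_below) (rule decseqD[OF dec], simp)
    then have "\<tau> * ((real k + 1) * ?a k) \<le> \<tau> * sum ?a {..<Suc k}"
      using \<tau>(1) by (intro mult_left_mono) (simp_all add: add.commute)
    also have "\<dots> \<le> ?D 0"
      using sum_le[of "Suc k"] zero_le_power2[of "norm (z (Suc k) - z_star)"] by linarith
    finally have "sqrt (\<tau> * (real k + 1) * ?a k) \<le> sqrt (?D 0)"
      by (intro real_sqrt_le_mono) (simp add: mult_ac)
    then have "sqrt (\<tau> * (real k + 1)) * norm (R (z k)) \<le> norm (z 0 - z_star)"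
      by (simp add: real_sqrt_mult)
    moreover have "0 < sqrt (\<tau> * (real k + 1))" using \<tau>(1) by simp
    ultimately show ?thesis by (simp add: pos_le_divide_eq mult.commute)
  qed
  show ?O
  proof (rule smalloI_tendsto)
    have "summable ?a"
    proof (rule summableI_nonneg_bounded)
      fix n
      have "\<tau> * sum ?a {..<n} \<le> ?D 0"
        using sum_le[of n] zero_le_power2[of "norm (z n - z_star)"] by linarith
      then show "sum ?a {..<n} \<le> ?D 0 / \<tau>"
        using \<tau>(1) by (simp add: pos_le_divide_eq mult.commute)
    qed simp
    from decseq_summable_imp_mult_tendsto_0[OF dec this]
    have "(\<lambda>k. sqrt ((real k + 1) * ?a k)) \<longlonglongrightarrow> sqrt 0"
      by (intro tendsto_real_sqrt) simp
    then show "((\<lambda>k. norm (R (z k)) / (1 / sqrt (real k + 1))) \<longlongrightarrow> 0) sequentially"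
      by (simp add: real_sqrt_mult mult.commute)
    have "1 / sqrt (real k + 1) > 0" for k by simp
    then have "1 / sqrt (real k + 1) \<noteq> 0" for k by (rule less_imp_neq[symmetric])
    then show "\<forall>\<^sub>F k in sequentially. 1 / sqrt (real k + 1) \<noteq> 0"
      by (rule always_eventually[OF allI])
  qed
qed

section \<open>Three-operator splitting\<close>

text \<open>Expand the squares and use the sign of the cross term. With \<open>p\<close>,
  \<open>q\<close> differences of resolvent values and of subgradients, these are nonexpansiveness
  of a resolvent \<open>J\<close> and of its reflection \<open>2 J - I\<close>.\<close>

lemma norm_le_norm_add_scaleR:
  fixes p q :: "'a::real_inner"
  assumes "0 \<le> p \<bullet> q" and "\<gamma> \<ge> 0"
  shows "norm p \<le> norm (p + \<gamma> *\<^sub>R q)" and "norm (p - \<gamma> *\<^sub>R q) \<le> norm (p + \<gamma> *\<^sub>R q)"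
proof -
  have pq: "0 \<le> \<gamma> * (p \<bullet> q)" using assms by simp
  have "(norm (p + \<gamma> *\<^sub>R q))\<^sup>2 = (norm p)\<^sup>2 + 2 * (\<gamma> * (p \<bullet> q)) + (norm (\<gamma> *\<^sub>R q))\<^sup>2"
    unfolding power2_norm_eq_inner by (simp add: inner_simps inner_commute)
  moreover have "(norm (p - \<gamma> *\<^sub>R q))\<^sup>2 = (norm p)\<^sup>2 - 2 * (\<gamma> * (p \<bullet> q)) + (norm (\<gamma> *\<^sub>R q))\<^sup>2"
    unfolding power2_norm_eq_inner by (simp add: inner_simps inner_commute)
  ultimately have "(norm p)\<^sup>2 \<le> (norm (p + \<gamma> *\<^sub>R q))\<^sup>2"
    "(norm (p - \<gamma> *\<^sub>R q))\<^sup>2 \<le> (norm (p + \<gamma> *\<^sub>R q))\<^sup>2"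
    using pq zero_le_power2[of "norm (\<gamma> *\<^sub>R q)"] by linarith+
  then show "norm p \<le> norm (p + \<gamma> *\<^sub>R q)" "norm (p - \<gamma> *\<^sub>R q) \<le> norm (p + \<gamma> *\<^sub>R q)"
    by (auto intro: power2_le_imp_le)
qed

text \<open>Here \<open>a\<close>, \<open>b\<close>, \<open>c\<close> and \<open>x\<close>, \<open>y\<close> are the differences of the values of \<open>A\<close>, \<open>B\<close>, \<open>C\<close> and of
  the points \<open>x\<^sub>g\<close>, \<open>x\<^sub>f\<close> belonging to two inputs of \<open>T\<close>; then \<open>x + \<gamma> b\<close> is the difference
  of the inputs and \<open>x - y\<close> that of the residuals.\<close>

lemma three_op_residual_cocoercive:
  fixes x y a b c :: "'a::real_inner"
  assumes \<gamma>: "\<gamma> > 0" and \<beta>: "\<beta> > 0"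
    and a: "0 \<le> y \<bullet> a" and b: "0 \<le> x \<bullet> b" and c: "\<beta> * (norm c)\<^sup>2 \<le> x \<bullet> c"
    and residual: "x - y = \<gamma> *\<^sub>R (a + b + c)"
  shows "(1 - \<gamma> / (4 * \<beta>)) * (norm (x - y))\<^sup>2 \<le> (x + \<gamma> *\<^sub>R b) \<bullet> (x - y)"
proof -
  define r where "r = x - y"
  have x: "x = y + r" by (simp add: r_def)
  have "y \<bullet> r = \<gamma> * (y \<bullet> a) + \<gamma> * (y \<bullet> b) + \<gamma> * (y \<bullet> c)"
    unfolding r_def residual by (simp add: inner_simps algebra_simps)
  \<comment> \<open>The residual equation trades \<open>y \<bullet> r\<close> for inner products
    with a known sign; only the last term is left to be estimated.\<close>
  then have expand: "(x + \<gamma> *\<^sub>R b) \<bullet> r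
      = (norm r)\<^sup>2 + \<gamma> * (y \<bullet> a) + \<gamma> * (x \<bullet> b) + \<gamma> * (x \<bullet> c - r \<bullet> c)"
    unfolding power2_norm_eq_inner x by (simp add: inner_simps inner_commute algebra_simps)
  \<comment> \<open>Young's inequality, weighted so that the cocoercivity term
    \<open>\<beta> * (norm c)\<^sup>2\<close> absorbs \<open>r \<bullet> c\<close> up to
    \<open>(norm r)\<^sup>2 / (4 * \<beta>)\<close>.\<close>
  have "0 \<le> \<beta> * (norm c - norm r / (2 * \<beta>))\<^sup>2" using \<beta> by simp
  also have "\<dots> = \<beta> * (norm c)\<^sup>2 - norm r * norm c + (norm r)\<^sup>2 / (4 * \<beta>)"
    using \<beta> by (simp add: power2_eq_square field_simps)
  finally have "- ((norm r)\<^sup>2 / (4 * \<beta>)) \<le> x \<bullet> c - r \<bullet> c"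
    using c norm_cauchy_schwarz[of r c] by linarith
  then have "\<gamma> * (- ((norm r)\<^sup>2 / (4 * \<beta>))) \<le> \<gamma> * (x \<bullet> c - r \<bullet> c)"
    using \<gamma> by (intro mult_left_mono) auto
  moreover have "0 \<le> \<gamma> * (y \<bullet> a)" "0 \<le> \<gamma> * (x \<bullet> b)" using a b \<gamma> by auto
  ultimately have "(norm r)\<^sup>2 - \<gamma> * ((norm r)\<^sup>2 / (4 * \<beta>)) \<le> (x + \<gamma> *\<^sub>R b) \<bullet> r"
    unfolding expand by linarith
  then show ?thesis by (simp add: r_def[symmetric] algebra_simps)
qed

text \<open>The lower bounds test the subgradients at the solution \<open>s\<close>, the upper bound
  those at \<open>x\<close> and \<open>y\<close>. Optimality at \<open>s\<close> and the residual
  equation turn the linear terms into inner products with \<open>x - y\<close>.\<close>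

lemma objective_gap_bounds:
  fixes f g :: "'a::real_inner \<Rightarrow> ereal" and h :: "'a \<Rightarrow> real" and C :: "'a \<Rightarrow> 'a"
  assumes f: "proper_closed_convex f" and g: "proper_closed_convex g"
    and h: "\<And>x y. h x + C x \<bullet> (y - x) \<le> h y"
    and a: "a \<in> subdifferential f y" and b: "b \<in> subdifferential g x"
    and a': "a' \<in> subdifferential f s" and b': "b' \<in> subdifferential g s"
    and opt: "a' + b' + C s = 0"
    and \<gamma>: "\<gamma> > 0" and residual: "x - y = \<gamma> *\<^sub>R (a + b + C x)"
  defines "gap \<equiv> \<lambda>y. real_of_ereal (f y) + real_of_ereal (g x) + h x
             - (real_of_ereal (f s) + real_of_ereal (g s) + h s)"
  shows objective_gap_lower: "- (norm (b' + C s) * norm (x - y)) \<le> gap y"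
    and objective_gap_upper: "gap y \<le> norm (x + \<gamma> *\<^sub>R b - s + \<gamma> *\<^sub>R C x) * norm (x - y) / \<gamma>"
    and objective_gap_nonneg: "\<bar>f x\<bar> \<noteq> \<infinity> \<Longrightarrow> 0 \<le> gap x"
proof -
  note fin = subdifferential_finite[OF f a] subdifferential_finite[OF f a']
    subdifferential_finite[OF g b] subdifferential_finite[OF g b']
  have a'_eq: "a' = - (b' + C s)" using opt by (simp only: eq_neg_iff_add_eq_0 add.assoc)
  \<comment> \<open>After eliminating \<open>a'\<close> by optimality, the three linear terms
    combine because \<open>(x - s) - (y - s) = x - y\<close>.\<close>
  have "(b' + C s) \<bullet> (x - y) \<le> gap y"
    using subdifferential_le[OF a' fin(2,1)] subdifferential_le[OF b' fin(4,3)] h[of s x]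
    unfolding gap_def a'_eq by (simp add: inner_simps)
  then show "- (norm (b' + C s) * norm (x - y)) \<le> gap y"
    using Cauchy_Schwarz_ineq2[of "b' + C s" "x - y"] by linarith
  have "gap y \<le> a \<bullet> (y - s) + b \<bullet> (x - s) + C x \<bullet> (x - s)"
    using subdifferential_le[OF a fin(1,2)] subdifferential_le[OF b fin(3,4)] h[of x s]
    unfolding gap_def by (simp add: inner_simps)
  also have "\<dots> = (a + b + C x) \<bullet> (x - s) - a \<bullet> (x - y)"
    by (simp add: inner_simps)
  \<comment> \<open>Multiply by \<open>\<gamma>\<close> and eliminate \<open>\<gamma> a\<close> by
    the residual equation; \<open>x + \<gamma> b\<close> is the input of the splitting map, and the
    negative square is dropped afterwards.\<close>
  also have "\<dots> = ((x - y) \<bullet> (x + \<gamma> *\<^sub>R b - s + \<gamma> *\<^sub>R C x) - (norm (x - y))\<^sup>2) / \<gamma>"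
  proof -
    have "\<gamma> *\<^sub>R a = (x - y) - \<gamma> *\<^sub>R b - \<gamma> *\<^sub>R C x"
      unfolding residual by (simp add: algebra_simps)
    then have "\<gamma> * (a \<bullet> (x - y)) = ((x - y) - \<gamma> *\<^sub>R b - \<gamma> *\<^sub>R C x) \<bullet> (x - y)"
      by (metis inner_scaleR_left)
    moreover have "\<gamma> * ((a + b + C x) \<bullet> (x - s)) = (x - y) \<bullet> (x - s)"
      unfolding residual by simp
    ultimately have "\<gamma> * ((a + b + C x) \<bullet> (x - s) - a \<bullet> (x - y)) =
        (x - y) \<bullet> (x - s) - ((x - y) - \<gamma> *\<^sub>R b - \<gamma> *\<^sub>R C x) \<bullet> (x - y)"
      by (simp only: right_diff_distrib)
    also have "\<dots> = (x - y) \<bullet> (x + \<gamma> *\<^sub>R b - s + \<gamma> *\<^sub>R C x) - (norm (x - y))\<^sup>2"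
      unfolding power2_norm_eq_inner by (simp add: inner_simps inner_commute)
    finally show ?thesis using \<gamma> by (simp add: eq_divide_eq mult.commute)
  qed
  also have "\<dots> \<le> norm (x + \<gamma> *\<^sub>R b - s + \<gamma> *\<^sub>R C x) * norm (x - y) / \<gamma>"
  proof (rule divide_right_mono)
    show "(x - y) \<bullet> (x + \<gamma> *\<^sub>R b - s + \<gamma> *\<^sub>R C x) - (norm (x - y))\<^sup>2
        \<le> norm (x + \<gamma> *\<^sub>R b - s + \<gamma> *\<^sub>R C x) * norm (x - y)"
      using norm_cauchy_schwarz[of "x - y" "x + \<gamma> *\<^sub>R b - s + \<gamma> *\<^sub>R C x"]
        zero_le_power2[of "norm (x - y)"]
      unfolding mult.commute[of "norm (x - y)"] by linarith
  qed (use \<gamma> in simp)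
  finally show "gap y \<le> norm (x + \<gamma> *\<^sub>R b - s + \<gamma> *\<^sub>R C x) * norm (x - y) / \<gamma>" .
  \<comment> \<open>With both functions evaluated at \<open>x\<close>, the displacement
    \<open>x - y\<close> of the lower bound becomes 0.\<close>
  show "0 \<le> gap x" if "\<bar>f x\<bar> \<noteq> \<infinity>"
    using subdifferential_le[OF a' fin(2) that] subdifferential_le[OF b' fin(4,3)] h[of s x]
    unfolding gap_def a'_eq by (simp add: inner_simps)
qed

theorem corollaryD3:
  fixes f g :: "'a::{real_inner, complete_space} \<Rightarrow> ereal"
    and h :: "'a \<Rightarrow> real"
    and grad_h :: "'a \<Rightarrow> 'a"
    and A B :: "'a \<Rightarrow> 'a set"
    and T :: "'a \<Rightarrow> 'a"
    and \<beta> \<epsilon> \<gamma> \<alpha> \<tau> :: real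
    and lam :: "nat \<Rightarrow> real"
    and z_star x_star uB_star :: 'a
    and z xg xf :: "nat \<Rightarrow> 'a"
  assumes "proper_closed_convex f"
    and "proper_closed_convex g"
    and "proper_closed_convex (\<lambda>x. ereal (h x))"
    and "\<beta> > 0"
    and "\<And>x. GDERIV h x :> grad_h x"
    and "(1 / \<beta>)-lipschitz_on UNIV grad_h"
    and "A = subdifferential f"
    and "B = subdifferential g"
    and "0 < \<epsilon>" and "\<epsilon> < 1"
    and "0 < \<gamma>" and "\<gamma> < 2 * \<beta> * \<epsilon>"
    and "\<alpha> = 1 / (2 - \<epsilon>)"
    and "\<And>j. 0 < lam j" and "\<And>j. lam j < 1 / \<alpha>"
    and "\<tau> = (INF j. lam j * (1 - \<alpha> * lam j) / \<alpha>)"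
    and "\<tau> > 0"
    and "T = three_op_map \<gamma> A B grad_h"
    and "T z_star = z_star"
    and "x_star = resolvent (scale_op \<gamma> B) z_star"
    and "uB_star = (1 / \<gamma>) *\<^sub>R (z_star - x_star)"
    and "\<And>k. z (Suc k) = (1 - lam k) *\<^sub>R z k + lam k *\<^sub>R T (z k)"
    and "\<And>k. xg k = resolvent (scale_op \<gamma> B) (z k)"
    and "\<And>k. xf k = resolvent (scale_op \<gamma> A) (2 *\<^sub>R xg k - z k - \<gamma> *\<^sub>R grad_h (xg k))"
  shows
    "((\<forall>k.
         ereal (- (norm (z 0 - z_star) * norm (uB_star + grad_h x_star)) / sqrt (\<tau> * (real k + 1)))
           \<le> f (xf k) + g (xg k) + ereal (h (xg k)) - (f x_star + g x_star + ereal (h x_star))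
       \<and> f (xf k) + g (xg k) + ereal (h (xg k)) - (f x_star + g x_star + ereal (h x_star))
           \<le> ereal ((norm (z_star - x_star) + (1 + \<gamma> / \<beta>) * norm (z 0 - z_star)
                       + \<gamma> * norm (grad_h x_star)) * norm (z 0 - z_star)
                     / (\<gamma> * sqrt (\<tau> * (real k + 1)))))
      \<and> (\<lambda>k. \<bar>real_of_ereal (f (xf k) + g (xg k) + ereal (h (xg k))
                              - (f x_star + g x_star + ereal (h x_star)))\<bar>)
          \<in> o(\<lambda>k. 1 / sqrt (real k + 1)))
   \<and> (\<forall>L. ereal_lipschitz_on L (cball x_star ((1 + \<gamma> / \<beta>) * norm (z 0 - z_star))) f \<longrightarrow>
        (\<forall>k.
           0 \<le> f (xg k) + g (xg k) + ereal (h (xg k)) - (f x_star + g x_star + ereal (h x_star))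
         \<and> f (xg k) + g (xg k) + ereal (h (xg k)) - (f x_star + g x_star + ereal (h x_star))
             \<le> ereal (((norm (z_star - x_star) + (1 + \<gamma> / \<beta>) * norm (z 0 - z_star)
                          + \<gamma> * norm (grad_h x_star)) * norm (z 0 - z_star)
                         + \<gamma> * L * norm (z 0 - z_star))
                       / (\<gamma> * sqrt (\<tau> * (real k + 1)))))
      \<and> (\<lambda>k. real_of_ereal (f (xg k) + g (xg k) + ereal (h (xg k))
                              - (f x_star + g x_star + ereal (h x_star))))
          \<in> o(\<lambda>k. 1 / sqrt (real k + 1)))"
proof -
  note f = assms(1) and g = assms(2) and \<beta> = assms(4) and grad = assms(5) and lip = assms(6)
    and \<gamma> = assms(11) and \<tau>_pos = assms(17)

  \<comment> \<open>Subgradients behind the two resolvents\<close>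
  define JB where "JB = resolvent (scale_op \<gamma> B)"
  define w where "w v = 2 *\<^sub>R JB v - v - \<gamma> *\<^sub>R grad_h (JB v)" for v
  define xF where "xF v = resolvent (scale_op \<gamma> A) (w v)" for v
  define a where "a v = (1 / \<gamma>) *\<^sub>R (w v - xF v)" for v
  define b where "b v = (1 / \<gamma>) *\<^sub>R (v - JB v)" for v
  define R where "R v = JB v - xF v" for v
  define D where "D = norm (z 0 - z_star)"

  have a: "a v \<in> subdifferential f (xF v)" for v
    using resolvent_subdifferential[OF f \<gamma>] by (simp add: a_def xF_def assms(7))
  have b: "b v \<in> subdifferential g (JB v)" for v
    using resolvent_subdifferential[OF g \<gamma>] by (simp add: b_def JB_def assms(8))
  have v_eq: "v = JB v + \<gamma> *\<^sub>R b v" for v using \<gamma> by (simp add: b_def)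
  have w_eq: "w v = xF v + \<gamma> *\<^sub>R a v" for v using \<gamma> by (simp add: a_def)
  have residual: "JB v - xF v = \<gamma> *\<^sub>R (a v + b v + grad_h (JB v))" for v
    using \<gamma> by (simp add: a_def b_def w_def algebra_simps scaleR_2)
  have T: "T v = v - R v" for v
    by (simp add: assms(18) three_op_map_def R_def xF_def w_def JB_def)
  have h_convex: "convex_on UNIV h"
    by (rule convex_on_if_proper_closed_convex[OF assms(3)])
  have h: "h x + grad_h x \<bullet> (y - x) \<le> h y" for x y
    by (rule convex_gradient_ineq[OF h_convex grad lip])
  have monA: "0 \<le> (xF v - xF v') \<bullet> (a v - a v')" for v v'
    by (rule subdifferential_monotone[OF f a a])
  have monB: "0 \<le> (JB v - JB v') \<bullet> (b v - b v')" for v v'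
    by (rule subdifferential_monotone[OF g b b])

  \<comment> \<open>Cocoercivity of the residual and its decay along the iteration\<close>
  have coco: "(norm (R v - R v'))\<^sup>2 \<le> 2 * \<alpha> * ((v - v') \<bullet> (R v - R v'))" for v v'
  proof -
    let ?N = "(norm (R v - R v'))\<^sup>2" and ?I = "(v - v') \<bullet> (R v - R v')"
    have 1: "(JB v - JB v') - (xF v - xF v') = R v - R v'" by (simp add: R_def)
    have 2: "(JB v - JB v') + \<gamma> *\<^sub>R (b v - b v') = v - v'"
      using v_eq[of v] v_eq[of v'] by (simp add: algebra_simps)
    have 3: "(JB v - JB v') - (xF v - xF v')
        = \<gamma> *\<^sub>R ((a v - a v') + (b v - b v') + (grad_h (JB v) - grad_h (JB v')))"
      using residual[of v] residual[of v'] by (simp add: algebra_simps)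
    have "(1 - \<gamma> / (4 * \<beta>)) * ?N \<le> ?I"
      using three_op_residual_cocoercive[OF \<gamma> \<beta> monA monB
          Baillon_Haddad[OF h_convex \<beta> grad lip] 3]
      by (simp only: 1 2)
    \<comment> \<open>From \<open>\<gamma> < 2 * \<beta> * \<epsilon>\<close>; the left side is
      \<open>1 / (2 * \<alpha>)\<close>, the constant that the averaged iteration expects.\<close>
    moreover have "1 - \<epsilon> / 2 \<le> 1 - \<gamma> / (4 * \<beta>)"
      using assms(12) \<beta> by (simp add: field_simps)
    then have "(1 - \<epsilon> / 2) * ?N \<le> (1 - \<gamma> / (4 * \<beta>)) * ?N"
      by (rule mult_right_mono) simp
    ultimately have "(1 - \<epsilon> / 2) * ?N \<le> ?I" by linarith
    moreover have "0 < 2 - \<epsilon>" using assms(10) by simp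
    ultimately show ?thesis by (simp add: assms(13) field_simps)
  qed
  have \<alpha>: "\<alpha> > 0" using assms(10,13) by simp
  have fixp: "R z_star = 0" using assms(19) by (simp add: T)
  have z_Suc: "z (Suc k) = z k - lam k *\<^sub>R R (z k)" for k
    by (simp add: assms(22) T algebra_simps)
  have \<tau>_le: "\<tau> \<le> lam k * (1 - \<alpha> * lam k) / \<alpha>" for k
  proof -
    \<comment> \<open>Nonnegativity bounds the family below, so that its \<open>INF\<close> is a
      genuine lower bound.\<close>
    have "0 \<le> lam j * (1 - \<alpha> * lam j) / \<alpha>" for j
      using assms(14)[of j] assms(15)[of j] \<alpha> by (simp add: field_simps)
    then have "bdd_below (range (\<lambda>j. lam j * (1 - \<alpha> * lam j) / \<alpha>))"
      by (intro bdd_belowI2)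
    then show ?thesis unfolding assms(16) by (rule cINF_lower) simp
  qed
  note KM = coco \<alpha> fixp assms(14,15) \<tau>_pos \<tau>_le z_Suc
  have Fejer: "norm (z k - z_star) \<le> D" for k
    unfolding D_def by (rule Krasnoselskii_Mann_Fejer[where R = R and z = z and lam = lam, OF KM])
  have R_le: "norm (R (z k)) \<le> D / sqrt (\<tau> * (real k + 1))" for k
    unfolding D_def by (rule Krasnoselskii_Mann_residual_bound[where R = R and z = z and lam = lam, OF KM])
  have R_smallo: "(\<lambda>k. norm (R (z k))) \<in> o(\<lambda>k. 1 / sqrt (real k + 1))"
    by (rule Krasnoselskii_Mann_residual_smallo[where R = R and z = z and lam = lam, OF KM])
  have smallo: "u \<in> o(\<lambda>k. 1 / sqrt (real k + 1))" if "\<And>k. \<bar>u k\<bar> \<le> K * norm (R (z k))"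
    for u :: "nat \<Rightarrow> real" and K
  proof -
    have "u \<in> O(\<lambda>k. norm (R (z k)))"
      using that by (intro bigoI[of _ K]) simp
    then show ?thesis using R_smallo by (rule landau_o.big_small_trans)
  qed

  \<comment> \<open>Subgradients at the solution and along the iterates\<close>
  have xs: "JB z_star = x_star" "xF z_star = x_star" "b z_star = uB_star"
    using fixp by (simp_all add: JB_def assms(20,21) R_def b_def)
  have xg: "xg k = JB (z k)" and xf: "xf k = xF (z k)" for k
    by (simp_all add: assms(23,24) JB_def xF_def w_def)
  have R: "R (z k) = xg k - xf k" for k by (simp add: R_def xg xf)
  \<comment> \<open>At the fixed point the residual equation becomes the optimality condition for
    \<open>f + g + h\<close>.\<close>
  have opt: "a z_star + uB_star + grad_h x_star = 0"
    using residual[of z_star] \<gamma> by (simp add: xs)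
  have a': "a z_star \<in> subdifferential f x_star" and b': "uB_star \<in> subdifferential g x_star"
    using a[of z_star] b[of z_star] by (simp_all add: xs)
  have ak: "a (z k) \<in> subdifferential f (xf k)" and bk: "b (z k) \<in> subdifferential g (xg k)" for k
    using a b by (simp_all add: xf xg)
  have resk: "xg k - xf k = \<gamma> *\<^sub>R (a (z k) + b (z k) + grad_h (xg k))" for k
    using residual by (simp add: xf xg)

  \<comment> \<open>Distances of the iterates to the solution\<close>
  have xg_near: "norm (xg k - x_star) \<le> norm (z k - z_star)" for k
  proof -
    have "norm (xg k - x_star) \<le> norm ((xg k - x_star) + \<gamma> *\<^sub>R (b (z k) - uB_star))"
      using monB[of "z k" z_star] \<gamma>
      by (intro norm_le_norm_add_scaleR) (simp_all add: xg xs)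
    also have "(xg k - x_star) + \<gamma> *\<^sub>R (b (z k) - uB_star) = z k - z_star"
      using v_eq[of "z k"] v_eq[of z_star] by (simp add: xg xs algebra_simps)
    finally show ?thesis .
  qed
  have grad_near: "norm (grad_h (xg k) - grad_h x_star) \<le> norm (z k - z_star) / \<beta>" for k
  proof -
    have "norm (grad_h (xg k) - grad_h x_star) \<le> norm (xg k - x_star) / \<beta>"
      using lipschitz_onD[OF lip, of "xg k" x_star] by (simp add: dist_norm)
    also have "\<dots> \<le> norm (z k - z_star) / \<beta>"
      using xg_near \<beta> by (simp add: divide_right_mono)
    finally show ?thesis .
  qed
  \<comment> \<open>The reflected resolvent of \<open>B\<close> contributes the factor 1 and the
    gradient step adds \<open>\<gamma> / \<beta>\<close>; the resolvent of \<open>A\<close> does not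
    increase the distance.\<close>
  have xf_near: "norm (xf k - x_star) \<le> (1 + \<gamma> / \<beta>) * norm (z k - z_star)" for k
  proof -
    have "norm (xf k - x_star) \<le> norm ((xf k - x_star) + \<gamma> *\<^sub>R (a (z k) - a z_star))"
      using monA[of "z k" z_star] \<gamma>
      by (intro norm_le_norm_add_scaleR) (simp_all add: xf xs)
    also have "(xf k - x_star) + \<gamma> *\<^sub>R (a (z k) - a z_star) = w (z k) - w z_star"
      by (simp add: w_eq xf xs algebra_simps)
    \<comment> \<open>Uses \<open>2 JB v - v = JB v - \<gamma> b v\<close>, the reflected resolvent
      in terms of the subgradient.\<close>
    also have "\<dots> = ((xg k - x_star) - \<gamma> *\<^sub>R (b (z k) - uB_star)) - \<gamma> *\<^sub>R (grad_h (xg k) - grad_h x_star)"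
      using v_eq[of "z k"] v_eq[of z_star] unfolding w_def xg xs
      by (simp add: algebra_simps scaleR_2)
    also have "norm \<dots> \<le> norm ((xg k - x_star) - \<gamma> *\<^sub>R (b (z k) - uB_star))
        + norm (\<gamma> *\<^sub>R (grad_h (xg k) - grad_h x_star))"
      by (rule norm_triangle_ineq4)
    also have "norm ((xg k - x_star) - \<gamma> *\<^sub>R (b (z k) - uB_star))
        \<le> norm ((xg k - x_star) + \<gamma> *\<^sub>R (b (z k) - uB_star))"
      using monB[of "z k" z_star] \<gamma>
      by (intro norm_le_norm_add_scaleR) (simp_all add: xg xs)
    also have "(xg k - x_star) + \<gamma> *\<^sub>R (b (z k) - uB_star) = z k - z_star"
      using v_eq[of "z k"] v_eq[of z_star] by (simp add: xg xs algebra_simps)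
    also have "norm (\<gamma> *\<^sub>R (grad_h (xg k) - grad_h x_star)) \<le> \<gamma> * (norm (z k - z_star) / \<beta>)"
      using mult_left_mono[OF grad_near[of k], of \<gamma>] \<gamma> by simp
    finally show ?thesis by (simp add: algebra_simps)
  qed

  \<comment> \<open>The objective gap as a real number\<close>
  define gap where "gap y x = real_of_ereal (f y) + real_of_ereal (g x) + h x
      - (real_of_ereal (f x_star) + real_of_ereal (g x_star) + h x_star)" for y x
  \<comment> \<open>Finiteness of \<open>f y\<close> is a separate assumption because it is
    automatic at \<open>xf k\<close> but comes from the Lipschitz hypothesis at \<open>xg k\<close>;
    the other values are finite by subgradients.\<close>
  have gap_eq: "f y + g (xg k) + ereal (h (xg k)) - (f x_star + g x_star + ereal (h x_star))
      = ereal (gap y (xg k))" if y: "\<bar>f y\<bar> \<noteq> \<infinity>" for y k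
  proof -
    have real: "\<exists>r. u = ereal r" if "\<bar>u\<bar> \<noteq> \<infinity>" for u
      using that by (cases u) auto
    obtain p q r s where "f y = ereal p" "f x_star = ereal q" "g x_star = ereal r" "g (xg k) = ereal s"
      using real[OF y] real[OF subdifferential_finite[OF f a']]
        real[OF subdifferential_finite[OF g b']] real[OF subdifferential_finite[OF g bk[of k]]]
      by blast
    then show ?thesis by (simp add: gap_def)
  qed
  note f_xf_finite = subdifferential_finite[OF f ak]
  note gap_bounds = f g h ak bk a' b' opt \<gamma> resk
  define M where "M = norm (uB_star + grad_h x_star)"
  \<comment> \<open>A bound for
    \<open>norm (z k - x_star + \<gamma> *\<^sub>R grad_h (xg k))\<close> uniform in
    \<open>k\<close>, by the Fejer property.\<close>
  define K where "K = norm (z_star - x_star) + (1 + \<gamma> / \<beta>) * D + \<gamma> * norm (grad_h x_star)"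
  have K_nonneg: "0 \<le> K" using \<gamma> \<beta> by (simp add: K_def D_def)
  have lower: "- (M * norm (R (z k))) \<le> gap (xf k) (xg k)" for k
    using objective_gap_lower[OF gap_bounds] by (simp add: gap_def M_def R)
  have upper: "gap (xf k) (xg k) \<le> K / \<gamma> * norm (R (z k))" for k
  proof -
    have "norm (z k - x_star + \<gamma> *\<^sub>R grad_h (xg k))
       \<le> norm (z k - z_star) + norm (z_star - x_star) + \<gamma> * (norm (z k - z_star) / \<beta> + norm (grad_h x_star))"
    proof -
      have "norm (grad_h (xg k)) \<le> norm (z k - z_star) / \<beta> + norm (grad_h x_star)"
        using grad_near[of k] norm_triangle_sub[of "grad_h (xg k)" "grad_h x_star"] by linarith
      then have "norm (\<gamma> *\<^sub>R grad_h (xg k)) \<le> \<gamma> * (norm (z k - z_star) / \<beta> + norm (grad_h x_star))"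
        using \<gamma> by simp
      moreover have "norm (z k - x_star) \<le> norm (z k - z_star) + norm (z_star - x_star)"
        using norm_triangle_ineq[of "z k - z_star" "z_star - x_star"] by simp
      ultimately show ?thesis
        using norm_triangle_ineq[of "z k - x_star" "\<gamma> *\<^sub>R grad_h (xg k)"] by linarith
    qed
    also have "\<dots> = norm (z_star - x_star) + (1 + \<gamma> / \<beta>) * norm (z k - z_star) + \<gamma> * norm (grad_h x_star)"
      by (simp add: algebra_simps)
    also have "\<dots> \<le> K"
      unfolding K_def using Fejer[of k] \<gamma> \<beta> by (intro add_mono mult_left_mono) auto
    finally have "norm (z k - x_star + \<gamma> *\<^sub>R grad_h (xg k)) \<le> K" .
    then have "norm (z k - x_star + \<gamma> *\<^sub>R grad_h (xg k)) * norm (R (z k)) / \<gamma> \<le> K * norm (R (z k)) / \<gamma>"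
      using \<gamma> by (intro divide_right_mono mult_right_mono) auto
    moreover have "xg k + \<gamma> *\<^sub>R b (z k) = z k" using v_eq[of "z k"] by (simp add: xg)
    ultimately show ?thesis
      using objective_gap_upper[OF gap_bounds, of k] by (simp add: gap_def R)
  qed
  have rate: "c * norm (R (z k)) \<le> c * D / sqrt (\<tau> * (real k + 1))" if "0 \<le> c" for c k
    using mult_left_mono[OF R_le that, of k] by simp

  \<comment> \<open>Rates with \<open>f\<close> evaluated at \<open>xf\<close>\<close>
  have part1: "ereal (- (D * M) / sqrt (\<tau> * (real k + 1))) \<le> ereal (gap (xf k) (xg k))
      \<and> ereal (gap (xf k) (xg k)) \<le> ereal (K * D / (\<gamma> * sqrt (\<tau> * (real k + 1))))" for k
  proof -
    have "- (D * M) / sqrt (\<tau> * (real k + 1)) \<le> gap (xf k) (xg k)"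
      using lower[of k] rate[of M k] by (simp add: M_def mult.commute)
    moreover have "gap (xf k) (xg k) \<le> K * D / (\<gamma> * sqrt (\<tau> * (real k + 1)))"
      using upper[of k] rate[of "K / \<gamma>" k] K_nonneg \<gamma> by simp
    ultimately show ?thesis by simp
  qed
  have part1_smallo: "(\<lambda>k. \<bar>gap (xf k) (xg k)\<bar>) \<in> o(\<lambda>k. 1 / sqrt (real k + 1))"
  proof (rule smallo)
    fix k
    \<comment> \<open>The sum of the two constants dominates both one-sided bounds.\<close>
    have "0 \<le> M * norm (R (z k))" "0 \<le> K / \<gamma> * norm (R (z k))"
      using K_nonneg \<gamma> by (simp_all add: M_def)
    then show "\<bar>\<bar>gap (xf k) (xg k)\<bar>\<bar> \<le> (M + K / \<gamma>) * norm (R (z k))"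
      using lower[of k] upper[of k] by (simp add: distrib_right abs_le_iff)
  qed

  \<comment> \<open>Rates with \<open>f\<close> evaluated at \<open>xg\<close>\<close>
  have part2: "(\<forall>k. 0 \<le> f (xg k) + g (xg k) + ereal (h (xg k)) - (f x_star + g x_star + ereal (h x_star))
         \<and> f (xg k) + g (xg k) + ereal (h (xg k)) - (f x_star + g x_star + ereal (h x_star))
             \<le> ereal ((K * D + \<gamma> * L * D) / (\<gamma> * sqrt (\<tau> * (real k + 1)))))
      \<and> (\<lambda>k. real_of_ereal (f (xg k) + g (xg k) + ereal (h (xg k))
             - (f x_star + g x_star + ereal (h x_star)))) \<in> o(\<lambda>k. 1 / sqrt (real k + 1))"
    if L: "ereal_lipschitz_on L (cball x_star ((1 + \<gamma> / \<beta>) * D)) f" for L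
  proof -
    have factor: "1 \<le> 1 + \<gamma> / \<beta>" using \<gamma> \<beta> by simp
    have xf_in: "xf k \<in> cball x_star ((1 + \<gamma> / \<beta>) * D)" for k
    proof -
      have "norm (xf k - x_star) \<le> (1 + \<gamma> / \<beta>) * D"
        by (rule order_trans[OF xf_near mult_left_mono[OF Fejer]]) (use factor in linarith)
      then show ?thesis by (simp add: dist_norm norm_minus_commute)
    qed
    \<comment> \<open>\<open>xg k\<close> even stays within \<open>D\<close> of
      \<open>x_star\<close>; the larger radius is dictated by \<open>xf k\<close>.\<close>
    have xg_in: "xg k \<in> cball x_star ((1 + \<gamma> / \<beta>) * D)" for k
    proof -
      have "norm (xg k - x_star) \<le> 1 * D"
        using xg_near[of k] Fejer[of k] by linarith
      also have "1 * D \<le> (1 + \<gamma> / \<beta>) * D"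
        by (rule mult_right_mono[OF factor]) (simp add: D_def)
      finally show ?thesis by (simp add: dist_norm norm_minus_commute)
    qed
    have fin: "\<bar>f (xg k)\<bar> \<noteq> \<infinity>" for k
      using L xg_in by (auto simp: ereal_lipschitz_on_def)
    have L_lip: "L-lipschitz_on (cball x_star ((1 + \<gamma> / \<beta>) * D)) (\<lambda>x. real_of_ereal (f x))"
      using L by (simp add: ereal_lipschitz_on_def)
    have L_nonneg: "0 \<le> L" by (rule lipschitz_on_nonneg[OF L_lip])
    have nonneg: "0 \<le> gap (xg k) (xg k)" for k
      using objective_gap_nonneg[OF gap_bounds fin] by (simp add: gap_def)
    have le: "gap (xg k) (xg k) \<le> (K / \<gamma> + L) * norm (R (z k))" for k
    proof -
      \<comment> \<open>Moving the argument of \<open>f\<close> from \<open>xf k\<close> to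
        \<open>xg k\<close> inside the ball costs at most \<open>L\<close> times the
        residual.\<close>
      have "gap (xg k) (xg k) - gap (xf k) (xg k) \<le> L * norm (R (z k))"
        using lipschitz_onD[OF L_lip xg_in xf_in, of k k] by (simp add: gap_def R dist_norm)
      then show ?thesis using upper[of k] by (simp add: distrib_right)
    qed
    have "gap (xg k) (xg k) \<le> (K * D + \<gamma> * L * D) / (\<gamma> * sqrt (\<tau> * (real k + 1)))" for k
    proof -
      have "(K / \<gamma> + L) * D / s = (K * D + \<gamma> * L * D) / (\<gamma> * s)" for s
        using \<gamma> by (simp add: add_divide_distrib distrib_right)
      then show ?thesis
        using le[of k] rate[of "K / \<gamma> + L" k] K_nonneg L_nonneg \<gamma> by simp
    qed
    moreover have "(\<lambda>k. gap (xg k) (xg k)) \<in> o(\<lambda>k. 1 / sqrt (real k + 1))"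
      using nonneg le by (intro smallo[of _ "K / \<gamma> + L"]) simp
    ultimately show ?thesis using nonneg by (simp add: gap_eq fin)
  qed
  show ?thesis
    unfolding gap_eq[OF f_xf_finite] real_of_ereal.simps D_def[symmetric] M_def[symmetric] K_def[symmetric]
    by (rule conjI[OF conjI[OF allI[OF part1] part1_smallo] allI[OF impI[OF part2]]])
qed

end
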